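(* Let $n\ge 6$ be an integer, and let $p$ and $q$ be (not necessarily distinct) primes such that $pq$ divides $n$ and $pq$ is coprime to $n/pq$. Let $S$ be an inverse-closed subset of $\mathbb{Z}_n\setminus\{0\}$ such that $\langle S\rangle=\mathbb{Z}_n$, $|S|=pq$ and $S$ is periodic. Then $\mathrm{Cay}(\mathbb{Z}_n,S)$ admits a total perfect code if and only if $s\not\equiv s'\pmod{pq}$ for all distinct $s,s'\in S$.
   Context: Inverse-closed means $-S=S$. The Cayley graph $\mathrm{Cay}(\mathbb{Z}_n,S)$ has vertex set $\mathbb{Z}_n$, with $x,y$ adjacent iff $y-x\in S$. A total perfect code in a graph is a set $C$ of vertices such that every vertex of the graph (including those in $C$) is adjacent to exactly one vertex of $C$. A nonempty subset $X$ of an abelian group $G$ is periodic if $\{g\in G: X+g=X\}\neq\{0\}$, and aperiodic otherwise. *)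

theory Defs
  imports
    "HOL-Algebra.Generated_Groups"
    "HOL-Algebra.Elementary_Groups"
    "HOL-Number_Theory.Cong"
    "HOL-Computational_Algebra.Primes"
    "Graph_Theory.Pair_Digraph"
begin

definition inverse_closed :: "('a, 'b) monoid_scheme \<Rightarrow> 'a set \<Rightarrow> bool" where
  "inverse_closed G S \<longleftrightarrow> set_inv\<^bsub>G\<^esub> S = S"

text \<open>In additive notation the translate is \<open>X + g\<close> and the neutral element is \<open>0\<close>.\<close>

definition periodic :: "('a, 'b) monoid_scheme \<Rightarrow> 'a set \<Rightarrow> bool" where
  "periodic G X \<longleftrightarrow>
     X \<noteq> {} \<and> X \<subseteq> carrier G \<and> {g \<in> carrier G. X #>\<^bsub>G\<^esub> g = X} \<noteq> {\<one>\<^bsub>G\<^esub>}"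

text \<open>Arcs are all pairs \<open>(x, y)\<close> with \<open>y - x \<in> S\<close> in additive notation. An undirected graph is
  represented, as usual in the graph library, by a symmetric digraph; symmetry and absence of
  loops are consequences of the assumptions on \<open>S\<close>, see \<open>pair_graph_cayley_graph\<close>.\<close>

definition cayley_graph :: "('a, 'b) monoid_scheme \<Rightarrow> 'a set \<Rightarrow> 'a pair_pre_digraph" where
  "cayley_graph G S =
     \<lparr>pverts = carrier G,
      parcs = {(x, y). x \<in> carrier G \<and> y \<in> carrier G \<and> y \<otimes>\<^bsub>G\<^esub> inv\<^bsub>G\<^esub> x \<in> S}\<rparr>"

lemma pair_graph_cayley_graph:
  assumes "group G" "finite (carrier G)"
    and S: "S \<subseteq> carrier G - {\<one>\<^bsub>G\<^esub>}" "inverse_closed G S"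
  shows "pair_graph (cayley_graph G S)"
proof -
  interpret group G by fact
  have *: "y \<otimes>\<^bsub>G\<^esub> inv\<^bsub>G\<^esub> x \<in> S" if "x \<otimes>\<^bsub>G\<^esub> inv\<^bsub>G\<^esub> y \<in> S" "x \<in> carrier G" "y \<in> carrier G" for x y
  proof -
    have "inv\<^bsub>G\<^esub> (x \<otimes>\<^bsub>G\<^esub> inv\<^bsub>G\<^esub> y) \<in> S"
      using that S(2) unfolding inverse_closed_def SET_INV_def by blast
    then show ?thesis using that by (simp add: inv_mult_group)
  qed
  have fin: "finite (parcs (cayley_graph G S))"
    by (rule finite_subset[of _ "carrier G \<times> carrier G"])
      (use assms in \<open>auto simp: cayley_graph_def\<close>)
  show ?thesis
    by unfold_locales
      (use assms fin * in \<open>auto simp: cayley_graph_def symmetric_def sym_def\<close>)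
qed

text \<open>\<open>v \<rightarrow>\<^bsub>G\<^esub> c\<close> is adjacency of \<open>v\<close> and \<open>c\<close> when \<open>G\<close> is symmetric.\<close>

definition total_perfect_code :: "('a, 'b) pre_digraph \<Rightarrow> 'a set \<Rightarrow> bool" where
  "total_perfect_code G C \<longleftrightarrow>
     C \<subseteq> verts G \<and> (\<forall>v \<in> verts G. \<exists>!c. c \<in> C \<and> v \<rightarrow>\<^bsub>G\<^esub> c)"

end

theory Submission
  imports Defs
begin

text \<open>
  A total perfect code \<open>C\<close> in the Cayley graph of \<open>S = - S\<close> is the same thing as a complement of
  \<open>S\<close>: every group element is uniquely \<open>c + s\<close> with \<open>c \<in> C\<close>, \<open>s \<in> S\<close>.  Write \<open>m = pq = |S|\<close>.

  If the elements of \<open>S\<close> are distinct modulo \<open>m\<close>, they form a complete residue system modulo \<open>m\<close>,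
  and the subgroup \<open>m\<int>\<^sub>n\<close> is a complement.

  Conversely, a complement \<open>C\<close> has \<open>n/m\<close> elements, a number coprime to \<open>m\<close>.  The theorem of
  Sands and Tijdeman (\<open>direct_factors_pow\<close>) then says that the multiple \<open>mC\<close> is a
  complement of \<open>S\<close> as well.  It has \<open>n/m\<close> elements and lies in \<open>m\<int>\<^sub>n\<close>, hence it is all of
  \<open>m\<int>\<^sub>n\<close>; and a set that has \<open>m\<int>\<^sub>n\<close> as a complement has at most one element in each residue class
  modulo \<open>m\<close>.

  The Sands--Tijdeman theorem reduces to multiplication by a prime \<open>r\<close> not dividing \<open>|C|\<close>.  Its
  group ring proof expands \<open>C(x)\<^sup>r S(x)\<close> and uses \<open>C(x)\<^sup>r \<equiv> C(x\<^sup>r)\<close> modulo \<open>r\<close>.  In the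
  combinatorial form used here, for a group element \<open>g\<close> one counts the
  words \<open>c\<^sub>1 \<dots> c\<^sub>r\<close> over \<open>C\<close> for which \<open>g - c\<^sub>1 - \<dots> - c\<^sub>r\<close> lies in \<open>S\<close>.  There are
  \<open>|C| ^ (r - 1)\<close> of them, as the last \<open>r - 1\<close> letters determine the first, and this
  is not divisible by \<open>r\<close>.  Since the cyclic group of order \<open>r\<close> permutes these words by rotation,
  one of them is constant, which writes \<open>g\<close> as an element of \<open>rC + S\<close>.
\<close>

section \<open>Permutations of prime order\<close>

text \<open>
  An orbit with fewer than \<open>r\<close> elements would contain a fixed point of \<open>f ^^ d\<close> for some \<open>d\<close>
  coprime to \<open>r\<close>, and this is a fixed point of \<open>f\<close>, which is a power of \<open>f ^^ d\<close>.  So \<open>X\<close> splits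
  into orbits of size \<open>r\<close>.
\<close>

lemma prime_dvd_card_if_no_fixpoint:
  assumes "finite X" and "prime (r::nat)"
    and fX: "\<And>x. x \<in> X \<Longrightarrow> f x \<in> X"
    and period: "\<And>x. x \<in> X \<Longrightarrow> (f ^^ r) x = x"
    and no_fix: "\<And>x. x \<in> X \<Longrightarrow> f x \<noteq> x"
  shows "r dvd card X"
proof -
  have "r > 1" using \<open>prime r\<close> by (rule prime_gt_1_nat)
  have iterX: "(f ^^ i) x \<in> X" if "x \<in> X" for i x
    using that fX by (induction i) auto
  have mod_r: "(f ^^ (i mod r)) x = (f ^^ i) x" if "x \<in> X" for i x
    using period[OF that] by (rule funpow_mod_eq)
  define R where "R = {(x, y). x \<in> X \<and> (\<exists>i. y = (f ^^ i) x)}"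
  have equiv: "equiv X R"
  proof (rule equivI)
    show "R \<subseteq> X \<times> X"
      using iterX by (auto simp: R_def)
    show "refl_on X R"
      unfolding R_def refl_on_def by (auto intro!: exI[of _ "0::nat"])
    show "sym R"
    proof (rule symI)
      fix x y assume "(x, y) \<in> R"
      then obtain i where "x \<in> X" and y: "y = (f ^^ i) x" by (auto simp: R_def)
      have "i * (r - 1) + i = i * r"
        using \<open>r > 1\<close> by (cases r) auto
      then have "(f ^^ (i * (r - 1))) y = (f ^^ (i * r)) x"
        unfolding y using funpow_add[of "i * (r - 1)" i f] by simp
      also have "\<dots> = x" using mod_r[OF \<open>x \<in> X\<close>, of "i * r"] by simp
      finally have "x = (f ^^ (i * (r - 1))) y" by simp
      then show "(y, x) \<in> R" using iterX[OF \<open>x \<in> X\<close>] y by (auto simp: R_def)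
    qed
    show "trans R"
    proof (rule transI)
      fix x y z assume "(x, y) \<in> R" "(y, z) \<in> R"
      then obtain i j where "x \<in> X" "z = (f ^^ j) ((f ^^ i) x)" by (auto simp: R_def)
      then have "z = (f ^^ (j + i)) x" by (simp add: funpow_add)
      then show "(x, z) \<in> R" using \<open>x \<in> X\<close> by (auto simp: R_def)
    qed
  qed
  show ?thesis
  proof (rule equiv_imp_dvd_card[OF \<open>finite X\<close> equiv])
    fix Y assume "Y \<in> X // R"
    then obtain x where "x \<in> X" and Y: "Y = R `` {x}" by (auto elim: quotientE)
    have "(f ^^ i) x \<in> (\<lambda>i. (f ^^ i) x) ` {..<r}" for i
      using mod_r[OF \<open>x \<in> X\<close>, of i] \<open>r > 1\<close> by (intro image_eqI[of _ _ "i mod r"]) auto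
    then have Y_eq: "Y = (\<lambda>i. (f ^^ i) x) ` {..<r}"
      using \<open>x \<in> X\<close> unfolding Y R_def by auto
    have "(f ^^ i) x \<noteq> (f ^^ j) x" if "i < j" "j < r" for i j
    proof
      assume "(f ^^ i) x = (f ^^ j) x"
      then have "(f ^^ (r - j)) ((f ^^ i) x) = (f ^^ (r - j)) ((f ^^ j) x)" by simp
      then have "(f ^^ (r - j + i)) x = (f ^^ (r - j + j)) x" by (simp add: funpow_add)
      then have fix_d: "(f ^^ (r - j + i)) x = x"
        using period[OF \<open>x \<in> X\<close>] \<open>j < r\<close> by simp
      define d where "d = r - j + i"
      have "0 < d" "d < r" using that by (auto simp: d_def)
      then have "coprime d r"
        using \<open>prime r\<close> by (metis coprime_commute nat_dvd_not_less prime_imp_coprime)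
      then obtain u where "[d * u = Suc 0] (mod r)" using cong_solve_coprime_nat by blast
      then have "(d * u) mod r = 1" using \<open>r > 1\<close> by (simp add: cong_def)
      then have "f x = (f ^^ (d * u)) x" using mod_r[OF \<open>x \<in> X\<close>, of "d * u"] by simp
      also have "\<dots> = x"
        using funpow_mod_eq[of d f x "d * u"] fix_d by (simp add: d_def)
      finally show False using no_fix \<open>x \<in> X\<close> by blast
    qed
    then have "inj_on (\<lambda>i. (f ^^ i) x) {..<r}"
      by (intro linorder_inj_onI) auto
    then show "r dvd card Y" by (simp add: Y_eq card_image)
  qed
qed

lemma rotate1_eq_imp_replicate:
  assumes "rotate1 (x # xs) = x # xs"
  shows "x # xs = replicate (Suc (length xs)) x"
proof -
  have "ys @ [x] = x # ys \<Longrightarrow> ys = replicate (length ys) x" for ys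
    by (induction ys) auto
  then show ?thesis using assms by auto
qed

section \<open>Factorizations of finite abelian groups\<close>

definition direct_factors :: "('a, 'b) monoid_scheme \<Rightarrow> 'a set \<Rightarrow> 'a set \<Rightarrow> bool" where
  "direct_factors G A B \<longleftrightarrow>
     A \<subseteq> carrier G \<and> B \<subseteq> carrier G \<and> bij_betw (\<lambda>(a, b). a \<otimes>\<^bsub>G\<^esub> b) (A \<times> B) (carrier G)"

lemma direct_factors_card:
  assumes "direct_factors G A B"
  shows "card A * card B = card (carrier G)"
  using assms bij_betw_same_card unfolding direct_factors_def
  by (metis card_cartesian_product)

context comm_group
begin

lemma foldr_mult_closed:
  "set xs \<subseteq> carrier G \<Longrightarrow> foldr (\<otimes>) xs \<one> \<in> carrier G"
  by (induction xs) auto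

lemma foldr_mult_rotate1:
  assumes "set xs \<subseteq> carrier G"
  shows "foldr (\<otimes>) (rotate1 xs) \<one> = foldr (\<otimes>) xs \<one>"
proof (cases xs)
  case (Cons x ys)
  have "set zs \<subseteq> carrier G \<Longrightarrow> foldr (\<otimes>) (zs @ [x]) \<one> = foldr (\<otimes>) zs \<one> \<otimes> x" for zs
    using assms Cons by (induction zs) (auto simp: foldr_mult_closed m_assoc)
  then show ?thesis
    using assms Cons by (auto simp: foldr_mult_closed m_comm)
qed simp

lemma foldr_mult_replicate:
  "a \<in> carrier G \<Longrightarrow> foldr (\<otimes>) (replicate k a) \<one> = a [^] k"
  by (induction k) (auto simp: m_comm)

text \<open>
  The bijection is given by deleting the first letter \<open>x\<close> of a word \<open>x # ys\<close>: for given \<open>ys\<close>, the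
  pair \<open>(x, b)\<close> is the factorization of \<open>g\<close> divided by the product of \<open>ys\<close>.
\<close>

lemma card_words_with_product:
  assumes fin: "finite (carrier G)" and AB: "direct_factors G A B" and g: "g \<in> carrier G"
  shows "card {xs. set xs \<subseteq> A \<and> length xs = Suc k \<and> (\<exists>b\<in>B. foldr (\<otimes>) xs \<one> \<otimes> b = g)} = card A ^ k"
    (is "card ?W = _")
proof -
  have A: "A \<subseteq> carrier G" and B: "B \<subseteq> carrier G"
    and bij: "bij_betw (\<lambda>(a, b). a \<otimes> b) (A \<times> B) (carrier G)"
    using AB by (auto simp: direct_factors_def)
  have move: "(x \<otimes> y) \<otimes> b = g \<longleftrightarrow> x \<otimes> b = g \<otimes> inv y"
    if "x \<in> carrier G" "y \<in> carrier G" "b \<in> carrier G" for x y b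
  proof -
    have "(x \<otimes> y) \<otimes> b = (x \<otimes> b) \<otimes> y" using that by (simp add: m_ac)
    then show ?thesis using that g inv_solve_right[of "x \<otimes> b" g y] by auto
  qed
  have uniq: "\<exists>!x. x \<in> A \<and> (\<exists>b\<in>B. (x \<otimes> y) \<otimes> b = g)" if y: "y \<in> carrier G" for y
  proof -
    have "g \<otimes> inv y \<in> (\<lambda>(a, b). a \<otimes> b) ` (A \<times> B)"
      using bij y g by (simp add: bij_betw_def)
    then obtain a b where ab: "a \<in> A" "b \<in> B" "a \<otimes> b = g \<otimes> inv y" by auto
    have "a' = a" if "a' \<in> A" "b' \<in> B" "a' \<otimes> b' = g \<otimes> inv y" for a' b'
      using bij_betw_imp_inj_on[OF bij] ab that by (auto dest: inj_onD[where x = "(a, b)" and y = "(a', b')"])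
    moreover have "(x \<otimes> y) \<otimes> b = g \<longleftrightarrow> x \<otimes> b = g \<otimes> inv y" if "x \<in> A" "b \<in> B" for x b
      using move[of x y b] that A B y by blast
    ultimately show ?thesis using ab by blast
  qed
  have prod: "foldr (\<otimes>) ys \<one> \<in> carrier G" if "set ys \<subseteq> A" for ys
    using foldr_mult_closed that A by blast
  have "bij_betw tl ?W {ys. set ys \<subseteq> A \<and> length ys = k}"
    unfolding bij_betw_def
  proof
    show "inj_on tl ?W"
    proof (rule inj_onI)
      fix xs xs' assume W: "xs \<in> ?W" "xs' \<in> ?W" and "tl xs = tl xs'"
      then obtain x x' ys where xs: "xs = x # ys" "xs' = x' # ys"
        by (cases xs; cases xs') auto
      have "foldr (\<otimes>) ys \<one> \<in> carrier G" using W(1) xs(1) by (intro prod) auto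
      moreover have "x \<in> A \<and> (\<exists>b\<in>B. (x \<otimes> foldr (\<otimes>) ys \<one>) \<otimes> b = g)"
        using W(1) xs(1) by simp
      moreover have "x' \<in> A \<and> (\<exists>b\<in>B. (x' \<otimes> foldr (\<otimes>) ys \<one>) \<otimes> b = g)"
        using W(2) xs(2) by simp
      ultimately have "x = x'" using uniq by blast
      then show "xs = xs'" using xs by simp
    qed
    show "tl ` ?W = {ys. set ys \<subseteq> A \<and> length ys = k}"
    proof (intro equalityI subsetI)
      fix ys assume "ys \<in> tl ` ?W"
      then obtain xs where "xs \<in> ?W" "ys = tl xs" by blast
      then show "ys \<in> {ys. set ys \<subseteq> A \<and> length ys = k}" by (cases xs) auto
    next
      fix ys assume ys: "ys \<in> {ys. set ys \<subseteq> A \<and> length ys = k}"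
      then have "foldr (\<otimes>) ys \<one> \<in> carrier G" by (intro prod) auto
      from ex1_implies_ex[OF uniq[OF this]]
      obtain x where "x \<in> A" "\<exists>b\<in>B. (x \<otimes> foldr (\<otimes>) ys \<one>) \<otimes> b = g" by blast
      then have "x # ys \<in> ?W" using ys by auto
      then show "ys \<in> tl ` ?W" by (metis (no_types, lifting) imageI list.sel(3))
    qed
  qed
  from bij_betw_same_card[OF this] show ?thesis
    by (simp only: card_lists_length_eq[OF finite_subset[OF A fin]])
qed

text \<open>
  A word \<open>a # \<dots> # a\<close> of length \<open>r\<close> whose product is \<open>g\<close> up to a factor in \<open>B\<close> factorizes \<open>g\<close> with an
  \<open>r\<close>-th power from \<open>A\<close>.  Such constant words are the fixed points of the rotation on the set of
  all words counted above, so if there were none, \<open>r\<close> would divide the power \<open>card A ^ (r - 1)\<close>.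
\<close>

lemma direct_factors_pow_prime:
  assumes fin: "finite (carrier G)" and AB: "direct_factors G A B"
    and "prime (r::nat)" and not_dvd: "\<not> r dvd card A"
  shows "direct_factors G ((\<lambda>a. a [^] r) ` A) B" and "card ((\<lambda>a. a [^] r) ` A) = card A"
proof -
  have A: "A \<subseteq> carrier G" and B: "B \<subseteq> carrier G"
    using AB by (auto simp: direct_factors_def)
  have finA: "finite A" and finB: "finite B" using A B fin finite_subset by blast+
  let ?P = "(\<lambda>a. a [^] r) ` A"
  have P: "?P \<subseteq> carrier G" using A by auto
  obtain t where r: "r = Suc t" using \<open>prime r\<close> by (metis not0_implies_Suc not_prime_0)
  have covers: "\<exists>a\<in>A. \<exists>b\<in>B. a [^] r \<otimes> b = g" if g: "g \<in> carrier G" for g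
  proof (rule ccontr)
    assume no: "\<not> ?thesis"
    define W where
      "W = {xs. set xs \<subseteq> A \<and> length xs = r \<and> (\<exists>b\<in>B. foldr (\<otimes>) xs \<one> \<otimes> b = g)}"
    have "r dvd card W"
    proof (rule prime_dvd_card_if_no_fixpoint[OF _ \<open>prime r\<close>])
      show "finite W"
        by (rule finite_subset[OF _ finite_lists_length_eq[OF finA, of r]]) (auto simp: W_def)
      show "rotate1 xs \<in> W" if "xs \<in> W" for xs
        using that foldr_mult_rotate1[of xs] A by (auto simp: W_def)
      show "(rotate1 ^^ r) xs = xs" if "xs \<in> W" for xs
        using that by (auto simp: W_def rotate_def[symmetric])
      show "rotate1 xs \<noteq> xs" if "xs \<in> W" for xs
      proof
        assume fix_xs: "rotate1 xs = xs"
        have len: "length xs = Suc t" and "set xs \<subseteq> A" using that r by (auto simp: W_def)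
        then obtain x ys where xs: "xs = x # ys" "length ys = t" by (cases xs) auto
        then have rep: "xs = replicate r x"
          using rotate1_eq_imp_replicate fix_xs r by metis
        have "x \<in> A" using xs(1) \<open>set xs \<subseteq> A\<close> by simp
        then have "foldr (\<otimes>) xs \<one> = x [^] r"
          using foldr_mult_replicate A unfolding rep by blast
        then show False using that no \<open>x \<in> A\<close> by (auto simp: W_def)
      qed
    qed
    moreover have "card W = card A ^ t"
      unfolding W_def r by (rule card_words_with_product[OF fin AB g])
    ultimately show False
      using \<open>prime r\<close> not_dvd prime_dvd_power by metis
  qed
  \<comment> \<open>There are at most \<open>|A| |B| = |G|\<close> products, and they cover \<open>G\<close>, so no two of them coincide.\<close>
  have surj: "(\<lambda>(a, b). a \<otimes> b) ` (?P \<times> B) = carrier G"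
  proof
    show "(\<lambda>(a, b). a \<otimes> b) ` (?P \<times> B) \<subseteq> carrier G" using P B by auto
    show "carrier G \<subseteq> (\<lambda>(a, b). a \<otimes> b) ` (?P \<times> B)"
    proof
      fix g assume "g \<in> carrier G"
      then obtain a b where "a \<in> A" "b \<in> B" "g = a [^] r \<otimes> b" using covers by blast
      then show "g \<in> (\<lambda>(a, b). a \<otimes> b) ` (?P \<times> B)"
        by (intro image_eqI[of _ _ "(a [^] r, b)"]) auto
    qed
  qed
  have upper: "card (carrier G) \<le> card ?P * card B"
    using card_image_le[of "?P \<times> B" "\<lambda>(a, b). a \<otimes> b"] finA finB surj
    by (simp add: card_cartesian_product)
  have AB_card: "card A * card B = card (carrier G)" by (rule direct_factors_card[OF AB])
  have "card (carrier G) > 0" using fin by (simp add: card_gt_0_iff carrier_not_empty)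
  then have "card B > 0" using AB_card by (metis gr0I mult_0_right)
  then have "card A \<le> card ?P" using upper AB_card by (metis mult_le_cancel2)
  then show card_P: "card ?P = card A" using card_image_le[OF finA] by (intro le_antisym)
  have "inj_on (\<lambda>(a, b). a \<otimes> b) (?P \<times> B)"
    by (rule eq_card_imp_inj_on) (use finA finB surj AB_card card_P in \<open>simp_all add: card_cartesian_product\<close>)
  then show "direct_factors G ?P B"
    using surj P B by (simp add: direct_factors_def bij_betw_def)
qed

text \<open>This is the Sands--Tijdeman theorem; powers with composite exponent are iterated prime powers.\<close>

theorem direct_factors_pow:
  assumes fin: "finite (carrier G)" and "direct_factors G A B"
    and "(r::nat) > 0" and "coprime r (card A)"
  shows "direct_factors G ((\<lambda>a. a [^] r) ` A) B \<and> card ((\<lambda>a. a [^] r) ` A) = card A"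
  using assms(2-)
proof (induction r arbitrary: A rule: prime_divisors_induct)
  case zero
  then show ?case by simp
next
  case (unit r)
  have "A \<subseteq> carrier G" using unit by (simp add: direct_factors_def)
  then have "(\<lambda>a. a [^] r) ` A = A" using unit by (force simp: subset_iff image_iff)
  then show ?case using unit by simp
next
  case (factor p r)
  let ?P = "(\<lambda>a. a [^] p) ` A"
  have A: "A \<subseteq> carrier G" using factor by (simp add: direct_factors_def)
  have "\<not> p dvd card A"
    using factor.prems(3) \<open>prime p\<close> by (metis coprime_mult_left_iff coprime_absorb_left not_prime_unit)
  then have P: "direct_factors G ?P B" "card ?P = card A"
    using direct_factors_pow_prime[OF fin factor.prems(1) \<open>prime p\<close>] by auto
  have "(\<lambda>a. a [^] (p * r)) ` A = (\<lambda>a. a [^] r) ` ?P"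
    using A by (force simp: image_iff nat_pow_pow)
  then show ?case
    using factor.IH[OF P(1)] P(2) factor.prems by simp
qed

section \<open>Total perfect codes as factors\<close>

text \<open>Inverse-closedness of \<open>S\<close> turns \<open>c - v \<in> S\<close> into \<open>v = c + s\<close> with \<open>s \<in> S\<close>.\<close>

lemma total_perfect_code_imp_direct_factors:
  assumes S: "S \<subseteq> carrier G" "inverse_closed G S"
    and code: "total_perfect_code (with_proj (cayley_graph G S)) C"
  shows "direct_factors G C S"
proof -
  have C: "C \<subseteq> carrier G"
    and ex1: "\<And>v. v \<in> carrier G \<Longrightarrow> \<exists>!c. c \<in> C \<and> c \<otimes> inv v \<in> S"
    using code by (auto simp: total_perfect_code_def cayley_graph_def subset_iff cong: conj_cong)
  have inv_S: "inv s \<in> S" if "s \<in> S" for s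
    using S(2) that unfolding inverse_closed_def SET_INV_def by blast
  have diff: "c \<otimes> inv (c \<otimes> s) = inv s" if "c \<in> C" "s \<in> S" for c s
    using that C S(1) by (simp add: subset_iff inv_mult m_assoc[symmetric])
  have "inj_on (\<lambda>(c, s). c \<otimes> s) (C \<times> S)"
  proof (rule inj_onI, clarify)
    fix c s c' s' assume cs: "c \<in> C" "s \<in> S" "c' \<in> C" "s' \<in> S" "c \<otimes> s = c' \<otimes> s'"
    then have "c \<otimes> inv (c \<otimes> s) \<in> S" "c' \<otimes> inv (c \<otimes> s) \<in> S"
      using diff inv_S by metis+
    then have "c = c'"
      using ex1[of "c \<otimes> s"] cs C S by blast
    then show "c = c' \<and> s = s'" using cs C S by (auto simp: subset_iff)
  qed
  moreover have "carrier G \<subseteq> (\<lambda>(c, s). c \<otimes> s) ` (C \<times> S)"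
  proof
    fix v assume v: "v \<in> carrier G"
    then obtain c where c: "c \<in> C" "c \<otimes> inv v \<in> S" using ex1 by blast
    then have "v = c \<otimes> inv (c \<otimes> inv v)"
      using v C by (simp add: subset_iff inv_mult m_assoc[symmetric])
    then show "v \<in> (\<lambda>(c, s). c \<otimes> s) ` (C \<times> S)" using c inv_S by force
  qed
  moreover have "(\<lambda>(c, s). c \<otimes> s) ` (C \<times> S) \<subseteq> carrier G" using C S(1) by auto
  ultimately show ?thesis
    using C S(1) unfolding direct_factors_def bij_betw_def by blast
qed

end

section \<open>Total perfect codes in circulant graphs\<close>

lemma card_multiples_below:
  assumes "m > 0" "m dvd n"
  shows "card {x \<in> {0..<int n}. int m dvd x} = n div m"
proof -
  obtain k where n: "n = m * k" using assms by blast
  have "{x \<in> {0..<int n}. int m dvd x} = (\<lambda>i. int m * int i) ` {..<k}"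
  proof (intro equalityI subsetI)
    fix x assume "x \<in> {x \<in> {0..<int n}. int m dvd x}"
    then obtain y where y: "x = int m * y" "0 \<le> x" "x < int m * int k" using n by auto
    then have "0 \<le> y" "y < int k" using assms by (auto simp: zero_le_mult_iff)
    then show "x \<in> (\<lambda>i. int m * int i) ` {..<k}"
      using y by (intro image_eqI[of _ _ "nat y"]) auto
  qed (use assms n in auto)
  moreover have "inj_on (\<lambda>i. int m * int i) {..<k}" using assms by (auto simp: inj_on_def)
  ultimately show ?thesis using n assms by (simp add: card_image)
qed

text \<open>
  The set \<open>mC\<close> is a complement of \<open>S\<close> and, by counting, the subgroup of all multiples of \<open>m\<close>.  Two
  congruent elements \<open>s\<close>, \<open>s'\<close> differ by a member \<open>d\<close> of this subgroup, and \<open>d + s' = 0 + s\<close> are two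
  factorizations of the same element.
\<close>

lemma incongruent_if_total_perfect_code:
  assumes "n > 0" "m > 0" "m dvd n" and cop: "coprime m (n div m)"
    and S: "S \<subseteq> carrier (integer_mod_group n)" "inverse_closed (integer_mod_group n) S"
    and "card S = m"
    and code: "total_perfect_code (with_proj (cayley_graph (integer_mod_group n) S)) C"
    and s: "s \<in> S" "s' \<in> S" "[s = s'] (mod int m)"
  shows "s = s'"
proof -
  let ?G = "integer_mod_group n"
  interpret comm_group ?G by simp
  have carr: "carrier ?G = {0..<int n}" using \<open>n > 0\<close> by (simp add: carrier_integer_mod_group)
  have CS: "direct_factors ?G C S"
    using total_perfect_code_imp_direct_factors S code by blast
  have "card C * m = n" using direct_factors_card[OF CS] \<open>card S = m\<close> carr by simp
  then have card_C: "card C = n div m" using \<open>m > 0\<close> by auto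
  define P where "P = (\<lambda>c. c [^]\<^bsub>?G\<^esub> m) ` C"
  have P: "direct_factors ?G P S" "card P = n div m"
    using direct_factors_pow[OF _ CS \<open>m > 0\<close>] cop card_C carr by (auto simp: P_def)
  have "int m dvd x" if "x \<in> P" for x
    using that \<open>m dvd n\<close> by (auto simp: P_def dvd_mod_iff)
  then have "P \<subseteq> {x \<in> {0..<int n}. int m dvd x}"
    using P(1) carr by (auto simp: direct_factors_def)
  moreover have "finite {x \<in> {0..<int n}. int m dvd x}"
    by (rule finite_subset[of _ "{0..<int n}"]) auto
  ultimately have P_eq: "P = {x \<in> {0..<int n}. int m dvd x}"
    using card_multiples_below[OF \<open>m > 0\<close> \<open>m dvd n\<close>] P(2) by (intro card_subset_eq) simp_all
  define d where "d = (s - s') mod int n"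
  have "int m dvd d"
    using s(3) \<open>m dvd n\<close> by (simp add: d_def dvd_mod_iff cong_iff_dvd_diff)
  then have "d \<in> P" "0 \<in> P" using \<open>n > 0\<close> by (auto simp: P_eq d_def)
  moreover have "(d + s') mod int n = (0 + s) mod int n"
    by (simp add: d_def mod_add_left_eq)
  moreover have "inj_on (\<lambda>(a, b). (a + b) mod int n) (P \<times> S)"
    using P(1) by (simp add: direct_factors_def bij_betw_def)
  ultimately have "(d, s') = (0, s)"
    using s by (auto dest: inj_onD[where x = "(d, s')" and y = "(0, s)"])
  then show ?thesis by simp
qed

text \<open>Since \<open>|S| = m\<close>, pairwise incongruent elements of \<open>S\<close> represent all residue classes modulo \<open>m\<close>.\<close>

lemma total_perfect_code_multiples:
  assumes "n > 0" "m > 0" "m dvd n"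
    and S: "S \<subseteq> carrier (integer_mod_group n)"
    and "card S = m"
    and incong: "\<And>s s'. s \<in> S \<Longrightarrow> s' \<in> S \<Longrightarrow> [s = s'] (mod int m) \<Longrightarrow> s = s'"
  shows "total_perfect_code (with_proj (cayley_graph (integer_mod_group n) S))
           {x \<in> {0..<int n}. int m dvd x}"
proof -
  let ?G = "integer_mod_group n"
  have carr: "carrier ?G = {0..<int n}" using \<open>n > 0\<close> by (simp add: carrier_integer_mod_group)
  have "inj_on (\<lambda>s. s mod int m) S"
    using incong by (auto simp: inj_on_def cong_def)
  moreover have "(\<lambda>s. s mod int m) ` S \<subseteq> {0..<int m}" using \<open>m > 0\<close> by auto
  ultimately have residues: "(\<lambda>s. s mod int m) ` S = {0..<int m}"
    using \<open>card S = m\<close> by (intro card_subset_eq) (auto simp: card_image)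
  have inv: "(c + inv\<^bsub>?G\<^esub> v) mod int n = (c - v) mod int n" if "v \<in> {0..<int n}" for c v
    using that carr by (simp add: mod_simps)
  have "\<exists>!c. c \<in> {0..<int n} \<and> int m dvd c \<and> (c - v) mod int n \<in> S"
    if v: "v \<in> {0..<int n}" for v
  proof -
    \<comment> \<open>A neighbour of \<open>v\<close> divisible by \<open>m\<close> is \<open>v + s\<close> for the representative \<open>s\<close> of \<open>- v\<close> in \<open>S\<close>.\<close>
    have "(- v) mod int m \<in> (\<lambda>s. s mod int m) ` S" using residues \<open>m > 0\<close> by simp
    then obtain s where s: "s \<in> S" "s mod int m = (- v) mod int m" by force
    have s_range: "s \<in> {0..<int n}" using s(1) S carr by blast
    show ?thesis
    proof (rule ex1I[of _ "(v + s) mod int n"])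
      have "int m dvd v + s"
        using s(2) by (metis mod_eq_dvd_iff diff_minus_eq_add add.commute)
      moreover have "((v + s) mod int n - v) mod int n = s"
        using s_range by (simp add: mod_diff_left_eq)
      ultimately show "(v + s) mod int n \<in> {0..<int n} \<and> int m dvd (v + s) mod int n \<and>
          ((v + s) mod int n - v) mod int n \<in> S"
        using s(1) \<open>n > 0\<close> \<open>m dvd n\<close> by (simp add: dvd_mod_iff)
    next
      fix c assume c: "c \<in> {0..<int n} \<and> int m dvd c \<and> (c - v) mod int n \<in> S"
      have "[(c - v) mod int n = - v] (mod int m)"
        using c \<open>m dvd n\<close> by (simp add: cong_def mod_mod_cancel mod_eq_dvd_iff)
      then have "(c - v) mod int n = s"
        using incong c s by (metis cong_def)
      then have "(v + s) mod int n = c mod int n" by (metis add.commute diff_add_cancel mod_add_left_eq)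
      then show "c = (v + s) mod int n" using c by simp
    qed
  qed
  then show ?thesis
    using inv carr
    by (auto simp: total_perfect_code_def cayley_graph_def simp del: inv_integer_mod_group cong: conj_cong)
qed

theorem theorem5p4:
  fixes n p q :: nat and S :: "int set"
  assumes "n \<ge> 6"
    and "prime p" and "prime q"
    and "p * q dvd n"
    and "coprime (p * q) (n div (p * q))"
    and "S \<subseteq> carrier (integer_mod_group n) - {\<one>\<^bsub>integer_mod_group n\<^esub>}"
    and "inverse_closed (integer_mod_group n) S"
    and "generate (integer_mod_group n) S = carrier (integer_mod_group n)"
    and "card S = p * q"
    and "periodic (integer_mod_group n) S"
  shows "(\<exists>C. total_perfect_code (with_proj (cayley_graph (integer_mod_group n) S)) C) \<longleftrightarrow>
    (\<forall>s \<in> S. \<forall>s' \<in> S. s \<noteq> s' \<longrightarrow> \<not> [s = s'] (mod int (p * q)))"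
proof -
  have pos: "n > 0" "p * q > 0" using assms(1-3) by (auto simp: prime_gt_0_nat)
  have S: "S \<subseteq> carrier (integer_mod_group n)" using assms(6) by blast
  show ?thesis
    using incongruent_if_total_perfect_code[OF pos assms(4,5) S assms(7,9)]
      total_perfect_code_multiples[OF pos assms(4) S assms(9)]
    by metis
qed

end
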